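(* For $n\ge1$ let $S_n(132)$ be the set of $132$-avoiding permutations of $\{1,\dots,n\}$, and for $\sigma=\sigma_1\cdots\sigma_n$ let $\mathrm{box}(\sigma)$ be the number of indices $i$ such that $|\sigma_i-\sigma_{i+1}|=1$ or $|\sigma_{i-1}-\sigma_i|=1$ (ignoring nonexistent entries). Let $A_n(x)=\sum_{\sigma\in S_n(132)}x^{\mathrm{box}(\sigma)}$, $B_n(x)=\sum_{\sigma\in S_n(132),\sigma_1=n}x^{\mathrm{box}(\sigma)}$, $E_n(x)=\sum_{\sigma\in S_n(132),\sigma_n=n}x^{\mathrm{box}(\sigma)}$. Then for $n\ge2$, $A_n(x)|_{x^2}=F_n$ and $B_n(x)|_{x^2}=E_n(x)|_{x^2}=F_{n-2}$.
   Context: A permutation $\sigma\in S_n$ avoids $132$ if there are no indices $i<j<k$ with $\sigma_i<\sigma_k<\sigma_j$. $P(x)|_{x^m}$ denotes the coefficient of $x^m$ in the polynomial $P(x)$. The Fibonacci numbers are defined by $F_0=F_1=1$ and $F_n=F_{n-1}+F_{n-2}$ for $n\ge2$. *)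

theory Defs
  imports
    "HOL-Combinatorics.Permutations"
    "HOL-Computational_Algebra.Polynomial"
begin

text \<open>Permutations of \<open>{1..n}\<close> are functions with \<^term>\<open>s permutes {1..n}\<close>; the value \<open>s i\<close> is the
  \<open>i\<close>-th entry (1-based) of the one-line notation.\<close>

definition avoids_132 :: "nat \<Rightarrow> (nat \<Rightarrow> nat) \<Rightarrow> bool" where
  "avoids_132 n s \<longleftrightarrow>
     \<not> (\<exists>i j k. 1 \<le> i \<and> i < j \<and> j < k \<and> k \<le> n \<and> s i < s k \<and> s k < s j)"

definition S132 :: "nat \<Rightarrow> (nat \<Rightarrow> nat) set" where
  "S132 n = {s. s permutes {1..n} \<and> avoids_132 n s}"

text \<open>The guards \<open>i < n\<close> and \<open>1 < i\<close> are needed because \<open>s 0 = 0\<close> and \<open>s (n + 1) = n + 1\<close>,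
  which must not count as entries.\<close>

definition box :: "nat \<Rightarrow> (nat \<Rightarrow> nat) \<Rightarrow> nat" where
  "box n s = card {i \<in> {1..n}.
     (i < n \<and> \<bar>int (s i) - int (s (i + 1))\<bar> = 1) \<or>
     (1 < i \<and> \<bar>int (s (i - 1)) - int (s i)\<bar> = 1)}"

definition A :: "nat \<Rightarrow> int poly" where
  "A n = (\<Sum>s\<in>S132 n. monom 1 (box n s))"

definition B :: "nat \<Rightarrow> int poly" where
  "B n = (\<Sum>s\<in>{s \<in> S132 n. s 1 = n}. monom 1 (box n s))"

definition E :: "nat \<Rightarrow> int poly" where
  "E n = (\<Sum>s\<in>{s \<in> S132 n. s n = n}. monom 1 (box n s))"

text \<open>Indexed so that \<open>F 0 = F 1 = 1\<close>, unlike the library's \<open>fib\<close>, which has \<open>fib 0 = 0\<close>.\<close>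

fun F :: "nat \<Rightarrow> nat" where
  "F 0 = 1"
| "F (Suc 0) = 1"
| "F (Suc (Suc n)) = F (Suc n) + F n"

end

theory Submission
  imports Defs
begin

text \<open>A permutation has box value 2 iff exactly one pair of neighbouring entries differs by 1. Write a
  132-avoiding word as \<open>v t w\<close> with \<open>t\<close> its maximum; then every entry of \<open>v\<close> exceeds every entry
  of \<open>w\<close>, and every such word of length at least 2 has an adjacency. Let \<open>a(n)\<close> count the words with
  exactly one adjacency, and \<open>b(n)\<close>, \<open>e(n)\<close> those among them that start, respectively end, with
  the maximum. Then \<open>b(n) = a(n-1) - b(n-1)\<close> and \<open>e(n) = a(n-1) - e(n-1)\<close> for \<open>n \<ge> 3\<close>. For
  \<open>n \<ge> 4\<close> an interior maximum forces \<open>w\<close> to have length one, so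
  \<open>a(n) = b(n) + e(n) + (a(n-2) - e(n-2))\<close>.\<close>

section \<open>Adjacencies and 132-avoidance for words\<close>

definition near :: "nat \<Rightarrow> nat \<Rightarrow> bool" where
  "near x y \<longleftrightarrow> x = Suc y \<or> y = Suc x"

definition adjs :: "nat list \<Rightarrow> nat" where
  "adjs w = length (filter (\<lambda>(x, y). near x y) (zip w (tl w)))"

lemma adjs_simps [simp]:
  "adjs [] = 0"
  "adjs [x] = 0"
  "adjs (x # y # w) = (if near x y then Suc (adjs (y # w)) else adjs (y # w))"
  by (simp_all add: adjs_def)

lemma adjs_Cons:
  "adjs (x # w) = adjs w + (if w \<noteq> [] \<and> near x (hd w) then 1 else 0)"
  by (cases w) auto

lemma adjs_append_Cons:
  "adjs (v @ x # w) = adjs v + adjs (x # w) + (if v \<noteq> [] \<and> near (last v) x then 1 else 0)"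
  by (induction v) (auto simp: adjs_Cons)

text \<open>Here \<open>x\<close> takes the role of the smallest letter of the pattern: a 132
  starting at \<open>x\<close> is a descent among the later letters above \<open>x\<close>.\<close>

fun avoiding :: "nat list \<Rightarrow> bool" where
  "avoiding [] = True"
| "avoiding (x # w) \<longleftrightarrow> sorted (filter ((<) x) w) \<and> avoiding w"

text \<open>A letter \<open>y\<close> of \<open>w\<close> above some \<open>x\<close> of
  \<open>v\<close> would complete the pattern \<open>x\<close>, \<open>t\<close>, \<open>y\<close>.
  Excluding this also excludes every other pattern that reaches across \<open>t\<close>, and
  \<open>t\<close> itself can never be the smallest letter of one.\<close>

lemma avoiding_append_max:
  assumes "\<forall>x\<in>set v \<union> set w. x < t"
  shows "avoiding (v @ t # w) \<longleftrightarrow>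
    avoiding v \<and> avoiding w \<and> (\<forall>x\<in>set v. \<forall>y\<in>set w. y \<le> x)"
  using assms
proof (induction v)
  case Nil
  then have "filter ((<) t) w = []" by (auto simp: filter_empty_conv)
  then show ?case by simp
next
  case (Cons x v)
  then have "x < t" by simp
  let ?p = "filter ((<) x) v" and ?q = "filter ((<) x) w"
  have lt: "\<forall>y\<in>set ?p \<union> set ?q. y < t" using Cons.prems by auto
  have "sorted (?p @ t # ?q) \<longleftrightarrow> sorted ?p \<and> ?q = []"
  proof
    assume "sorted (?p @ t # ?q)"
    then have "sorted ?p" "\<forall>y\<in>set ?q. t \<le> y" by (simp_all add: sorted_append)
    moreover have "?q = []"
    proof (rule ccontr)
      assume "?q \<noteq> []"
      then have "hd ?q \<in> set ?q" by (rule hd_in_set)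
      then show False using lt calculation(2) by (meson UnI2 leD)
    qed
    ultimately show "sorted ?p \<and> ?q = []" by simp
  qed (use lt in \<open>auto simp: sorted_append less_imp_le\<close>)
  moreover have "?q = [] \<longleftrightarrow> (\<forall>y\<in>set w. y \<le> x)" by (auto simp: filter_empty_conv not_less)
  ultimately have "sorted (filter ((<) x) (v @ t # w)) \<longleftrightarrow> sorted ?p \<and> (\<forall>y\<in>set w. y \<le> x)"
    using \<open>x < t\<close> by simp
  then show ?case using Cons by auto
qed

section \<open>Words over an interval and their decomposition at the maximum\<close>

text \<open>Letters range over an arbitrary interval, so that the two blocks around the maximum are again
  words of this kind and never have to be standardised.\<close>

definition words :: "nat \<Rightarrow> nat \<Rightarrow> nat list set" where
  "words m t = {w. distinct w \<and> avoiding w \<and> set w = {m<..t}}"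

lemma length_words: "w \<in> words m t \<Longrightarrow> length w = t - m"
  by (auto simp: words_def dest: distinct_card)

lemma words_self [simp]: "words m m = {[]}"
  by (auto simp: words_def)

lemma finite_words: "finite (words m t)"
proof (rule finite_subset)
  show "words m t \<subseteq> {w. set w \<subseteq> {m<..t} \<and> length w = t - m}"
    by (auto simp: length_words) (auto simp: words_def)
qed (simp add: finite_lists_length_eq)

text \<open>The cut \<open>u\<close> is the largest element of \<open>b\<close>, or \<open>m\<close>
  if \<open>b\<close> is empty. Disjointness makes every element of \<open>a\<close> strictly larger
  than the cut, and the union being an interval leaves no gaps.\<close>

lemma split_interval:
  fixes a b :: "nat set"
  assumes un: "a \<union> b = {m<..t}" and "a \<inter> b = {}" and le: "\<forall>x\<in>a. \<forall>y\<in>b. y \<le> x" and "m \<le> t"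
  obtains u where "m \<le> u" "u \<le> t" "a = {u<..t}" "b = {m<..u}"
proof (cases "b = {}")
  case True
  then show ?thesis using that[of m] assms by auto
next
  case False
  have "finite b" by (rule finite_subset[of _ "{m<..t}"]) (use un in auto)
  then have max: "Max b \<in> b" "\<And>y. y \<in> b \<Longrightarrow> y \<le> Max b" using False by auto
  have range: "m < Max b" "Max b \<le> t" using max(1) un by auto
  have gt: "Max b < x" if "x \<in> a" for x
  proof -
    have "Max b \<le> x" using that le max(1) by blast
    moreover have "Max b \<noteq> x" using that max(1) assms(2) by blast
    ultimately show ?thesis by simp
  qed
  have mem: "x \<in> a \<or> x \<in> b \<longleftrightarrow> m < x \<and> x \<le> t" for x
    using un by (simp add: set_eq_iff)
  have "a = {Max b<..t}"
  proof (intro equalityI subsetI)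
    fix x assume "x \<in> {Max b<..t}"
    then have "m < x" "x \<le> t" "x \<notin> b" using range max(2)[of x] by auto
    then show "x \<in> a" using mem by blast
  qed (use gt mem in auto)
  moreover have "b = {m<..Max b}"
  proof (intro equalityI subsetI)
    fix x assume "x \<in> {m<..Max b}"
    then have "m < x" "x \<le> t" "x \<notin> a" using range gt[of x] by auto
    then show "x \<in> b" using mem by blast
  qed (use max(2) mem in auto)
  ultimately show ?thesis using that[of "Max b"] range by simp
qed

lemma words_Suc_intro:
  assumes "m \<le> u" "u \<le> t" "v \<in> words u t" "w \<in> words m u"
  shows "v @ Suc t # w \<in> words m (Suc t)"
proof -
  have "avoiding (v @ Suc t # w)"
    using assms by (subst avoiding_append_max) (auto simp: words_def)
  then show ?thesis using assms by (auto simp: words_def)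
qed

text \<open>Converse of \<open>words_Suc_intro\<close>. The cut \<open>u\<close> determines where
  the maximum stands: the left block has \<open>t - u\<close> letters and the right block
  \<open>u - m\<close>, and each is again a word over an interval.\<close>

lemma words_Suc_cases:
  assumes "x \<in> words m (Suc t)" "m \<le> t"
  obtains u v w where "m \<le> u" "u \<le> t" "v \<in> words u t" "w \<in> words m u" "x = v @ Suc t # w"
proof -
  have "Suc t \<in> set x" using assms by (simp add: words_def)
  then obtain v w where x: "x = v @ Suc t # w" by (meson split_list)
  have un: "set v \<union> set w = {m<..t}" and disj: "set v \<inter> set w = {}"
  proof -
    have "set v \<union> set w = set x - {Suc t}" using assms by (auto simp: x words_def)
    also have "set x = {m<..Suc t}" using assms by (simp add: words_def)
    also have "{m<..Suc t} - {Suc t} = {m<..t}" by auto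
    finally show "set v \<union> set w = {m<..t}" .
  qed (use assms in \<open>auto simp: x words_def\<close>)
  have "\<forall>y\<in>set v \<union> set w. y < Suc t" unfolding un by auto
  then have av: "avoiding v" "avoiding w" "\<forall>y\<in>set v. \<forall>z\<in>set w. z \<le> y"
    using assms(1) unfolding x by (auto simp: words_def avoiding_append_max)
  obtain u where u: "m \<le> u" "u \<le> t" "set v = {u<..t}" "set w = {m<..u}"
    using split_interval[OF un disj av(3) assms(2)] .
  moreover have "distinct v" "distinct w" using assms(1) by (simp_all add: x words_def)
  ultimately have "v \<in> words u t" "w \<in> words m u" using av(1,2) unfolding words_def by simp_all
  then show ?thesis using that u x by blast
qed

text \<open>All letters of the blocks are at most \<open>t\<close>, so only \<open>t\<close> can be
  near \<open>Suc t\<close>. The guards \<open>u < t\<close> and \<open>m < u\<close> say that a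
  block is nonempty, because \<open>last []\<close> and \<open>hd []\<close> are
  unspecified.\<close>

lemma adjs_words_Suc:
  assumes "m \<le> u" "u \<le> t" "v \<in> words u t" "w \<in> words m u"
  shows "adjs (v @ Suc t # w) = adjs v + adjs w
    + (if u < t \<and> last v = t then 1 else 0) + (if m < u \<and> hd w = t then 1 else 0)"
proof -
  have ne: "v \<noteq> [] \<longleftrightarrow> u < t" "w \<noteq> [] \<longleftrightarrow> m < u"
    using assms length_words[of v u t] length_words[of w m u]
    unfolding length_greater_0_conv[symmetric] by simp_all
  have "last v \<le> t" if "v \<noteq> []" using last_in_set[OF that] assms by (auto simp: words_def)
  moreover have "hd w \<le> t" if "w \<noteq> []" using hd_in_set[OF that] assms by (auto simp: words_def)
  ultimately show ?thesis
    by (auto simp: adjs_append_Cons adjs_Cons near_def ne[symmetric])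
qed

lemma words_one [simp]: "words m (Suc m) = {[Suc m]}"
proof -
  have "[Suc m] \<in> words m (Suc m)" using words_Suc_intro[of m m m "[]" "[]"] by simp
  moreover have "w = [Suc m]" if "w \<in> words m (Suc m)" for w
    using that by (rule words_Suc_cases) auto
  ultimately show ?thesis by blast
qed

text \<open>Induction on the length: a block of length at least two has an adjacency already, and if
  both blocks are shorter, the second largest letter stands next to the maximum.\<close>

lemma adjs_pos:
  assumes "w \<in> words m t" "m + 2 \<le> t"
  shows "adjs w > 0"
  using assms
proof (induction "t - m" arbitrary: m t w rule: less_induct)
  case less
  obtain t' where t: "t = Suc t'" "m < t'" using less.prems by (cases t) auto
  obtain u x y where u: "m \<le> u" "u \<le> t'" and xy: "x \<in> words u t'" "y \<in> words m u"
    and w: "w = x @ Suc t' # y"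
    using less.prems t words_Suc_cases[of w m t'] by auto
  have adj: "adjs w = adjs x + adjs y
      + (if u < t' \<and> last x = t' then 1 else 0) + (if m < u \<and> hd y = t' then 1 else 0)"
    unfolding w using u xy by (rule adjs_words_Suc)
  \<comment> \<open>In the last two cases a block is the single letter \<open>t'\<close>: the left
    one if \<open>t' = Suc u\<close>, otherwise the right one, the left one being empty.\<close>
  consider "u + 2 \<le> t'" | "m + 2 \<le> u" | "t' = Suc u" | "u = t'" "u = Suc m"
    using u t by linarith
  then show ?case
  proof cases
    case 1
    then have "adjs x > 0" using less.hyps[of t' u x] u t xy by auto
    then show ?thesis using adj by simp
  next
    case 2
    then have "adjs y > 0" using less.hyps[of u m y] u t xy by auto
    then show ?thesis using adj by simp
  next
    case 3
    then show ?thesis using adj xy by auto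
  next
    case 4
    then show ?thesis using adj xy by auto
  qed
qed

section \<open>Words with exactly one adjacency, by the position of the maximum\<close>

definition single :: "nat \<Rightarrow> nat \<Rightarrow> nat list set" where
  "single m t = {w \<in> words m t. adjs w = 1}"

lemma finite_single: "finite (single m t)"
  by (simp add: single_def finite_words)

text \<open>The blocks do not contain \<open>Suc t\<close>, so the maximum stands at an end exactly
  when the block on that side is empty.\<close>

lemma hd_last_append:
  assumes "m \<le> u" "u \<le> t" "v \<in> words u t" "w \<in> words m u"
  shows "hd (v @ Suc t # w) = Suc t \<longleftrightarrow> u = t" "last (v @ Suc t # w) = Suc t \<longleftrightarrow> u = m"
proof -
  have "hd v \<noteq> Suc t" if "v \<noteq> []" using hd_in_set[OF that] assms by (auto simp: words_def)
  then show "hd (v @ Suc t # w) = Suc t \<longleftrightarrow> u = t"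
    using assms length_words[of v u t] by (cases v) auto
  have "last w \<noteq> Suc t" if "w \<noteq> []" using last_in_set[OF that] assms by (auto simp: words_def)
  then show "last (v @ Suc t # w) = Suc t \<longleftrightarrow> u = m"
    using assms length_words[of w m u] by (cases "w = []") auto
qed

text \<open>By \<open>adjs_pos\<close> the remaining word \<open>v\<close>, of length at least two,
  has an adjacency of its own. It must be the only one, so the appended maximum may not follow
  \<open>t\<close>.\<close>

lemma single_last_max:
  assumes "m + 2 \<le> t"
  shows "{w \<in> single m (Suc t). last w = Suc t} = (\<lambda>v. v @ [Suc t]) ` {v \<in> single m t. last v \<noteq> t}"
proof (intro equalityI subsetI)
  fix x assume "x \<in> {w \<in> single m (Suc t). last w = Suc t}"
  then have x: "x \<in> words m (Suc t)" "adjs x = 1" "last x = Suc t" by (auto simp: single_def)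
  obtain u v w where d: "m \<le> u" "u \<le> t" "v \<in> words u t" "w \<in> words m u" "x = v @ Suc t # w"
    using words_Suc_cases[OF x(1)] assms by auto
  have [simp]: "u = m" using hd_last_append(2)[OF d(1-4)] d(5) x(3) by simp
  have "w = []" using d by simp
  moreover have "adjs v > 0" using adjs_pos[of v m t] d assms by simp
  then have "adjs v = 1" "last v \<noteq> t"
    using adjs_words_Suc[OF d(1-4)] x d(5) assms by (auto split: if_splits)
  ultimately show "x \<in> (\<lambda>v. v @ [Suc t]) ` {v \<in> single m t. last v \<noteq> t}"
    using d by (auto simp: single_def)
next
  fix x assume "x \<in> (\<lambda>v. v @ [Suc t]) ` {v \<in> single m t. last v \<noteq> t}"
  then obtain v where v: "x = v @ [Suc t]" "v \<in> words m t" "adjs v = 1" "last v \<noteq> t"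
    by (auto simp: single_def)
  then show "x \<in> {w \<in> single m (Suc t). last w = Suc t}"
    using words_Suc_intro[of m m t v "[]"] adjs_words_Suc[of m m t v "[]"] assms
    by (auto simp: single_def)
qed

text \<open>Same argument as for \<open>single_last_max\<close>, with the maximum put in front and
  the left block empty.\<close>

lemma single_hd_max:
  assumes "m + 2 \<le> t"
  shows "{w \<in> single m (Suc t). hd w = Suc t} = (\<lambda>v. Suc t # v) ` {v \<in> single m t. hd v \<noteq> t}"
proof (intro equalityI subsetI)
  fix x assume "x \<in> {w \<in> single m (Suc t). hd w = Suc t}"
  then have x: "x \<in> words m (Suc t)" "adjs x = 1" "hd x = Suc t" by (auto simp: single_def)
  obtain u v w where d: "m \<le> u" "u \<le> t" "v \<in> words u t" "w \<in> words m u" "x = v @ Suc t # w"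
    using words_Suc_cases[OF x(1)] assms by auto
  have [simp]: "u = t" using hd_last_append(1)[OF d(1-4)] d(5) x(3) by simp
  have "v = []" using d by simp
  moreover have "adjs w > 0" using adjs_pos[of w m t] d assms by simp
  then have "adjs w = 1" "hd w \<noteq> t"
    using adjs_words_Suc[OF d(1-4)] x d(5) assms by (auto split: if_splits)
  ultimately show "x \<in> (\<lambda>v. Suc t # v) ` {v \<in> single m t. hd v \<noteq> t}"
    using d by (auto simp: single_def)
next
  fix x assume "x \<in> (\<lambda>v. Suc t # v) ` {v \<in> single m t. hd v \<noteq> t}"
  then obtain v where v: "x = Suc t # v" "v \<in> words m t" "adjs v = 1" "hd v \<noteq> t"
    by (auto simp: single_def)
  then show "x \<in> {w \<in> single m (Suc t). hd w = Suc t}"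
    using words_Suc_intro[of m t t "[]" v] adjs_words_Suc[of m t t "[]" v] assms
    by (auto simp: single_def)
qed

text \<open>If the maximum is interior, both blocks around it are nonempty. A block of length at least
  two contains an adjacency, and a left block of length one is adjacent to the maximum; so the right
  block has length one.\<close>

lemma single_max_interior:
  assumes "m + 3 \<le> t"
  shows "{w \<in> single m (Suc t). hd w \<noteq> Suc t \<and> last w \<noteq> Suc t} =
    (\<lambda>v. v @ [Suc t, Suc m]) ` {v \<in> single (Suc m) t. last v \<noteq> t}"
proof (intro equalityI subsetI)
  fix x assume "x \<in> {w \<in> single m (Suc t). hd w \<noteq> Suc t \<and> last w \<noteq> Suc t}"
  then have x: "x \<in> words m (Suc t)" "adjs x = 1" "hd x \<noteq> Suc t" "last x \<noteq> Suc t"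
    by (auto simp: single_def)
  obtain u v w where d: "m \<le> u" "u \<le> t" "v \<in> words u t" "w \<in> words m u" "x = v @ Suc t # w"
    using words_Suc_cases[OF x(1)] assms by auto
  have u: "m < u" "u < t" using hd_last_append[OF d(1-4)] d(1,2,5) x(3,4) by auto
  have adj: "adjs v + adjs w + (if last v = t then 1 else 0) + (if hd w = t then 1 else 0) = 1"
    using adjs_words_Suc[OF d(1-4)] x d(5) u by auto
  have v: "adjs v > 0 \<or> last v = t"
  proof (cases "u + 2 \<le> t")
    case True
    then show ?thesis using adjs_pos[of v u t] d by simp
  next
    case False
    then have "t = Suc u" using u by simp
    then show ?thesis using d by simp
  qed
  then have "adjs w = 0" using adj by (auto split: if_splits)
  then have "\<not> m + 2 \<le> u" using adjs_pos[of w m u] d by auto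
  then have [simp]: "u = Suc m" using u by simp
  have "w = [Suc m]" using d by simp
  \<comment> \<open>Now \<open>v\<close> has \<open>t - Suc m\<close> letters, at least two by
    assumption, so the one adjacency lies inside \<open>v\<close> and not between \<open>v\<close>
    and the maximum.\<close>
  moreover have "adjs v > 0" using adjs_pos[of v u t] d assms by simp
  then have "adjs v = 1" "last v \<noteq> t"
    using adj by (auto split: if_splits)
  ultimately show "x \<in> (\<lambda>v. v @ [Suc t, Suc m]) ` {v \<in> single (Suc m) t. last v \<noteq> t}"
    using d by (auto simp: single_def)
next
  fix x assume "x \<in> (\<lambda>v. v @ [Suc t, Suc m]) ` {v \<in> single (Suc m) t. last v \<noteq> t}"
  then obtain v where v: "x = v @ [Suc t, Suc m]" "v \<in> words (Suc m) t" "adjs v = 1" "last v \<noteq> t"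
    by (auto simp: single_def)
  then show "x \<in> {w \<in> single m (Suc t). hd w \<noteq> Suc t \<and> last w \<noteq> Suc t}"
    using words_Suc_intro[of m "Suc m" t v "[Suc m]"] adjs_words_Suc[of m "Suc m" t v "[Suc m]"]
      hd_last_append[of m "Suc m" t v "[Suc m]"] assms
    by (auto simp: single_def)
qed

section \<open>Small cases and the Fibonacci count\<close>

text \<open>The first two classes are disjoint because the cut of a word of length at least two
  cannot lie at both ends of the interval.\<close>

lemma card_single_split:
  assumes "m + 2 \<le> t"
  shows "card (single m t) = card {w \<in> single m t. hd w = t} + card {w \<in> single m t. last w = t}
    + card {w \<in> single m t. hd w \<noteq> t \<and> last w \<noteq> t}"
proof -
  have "hd w \<noteq> t \<or> last w \<noteq> t" if "w \<in> single m t" for w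
  proof -
    obtain t' where t: "t = Suc t'" "m \<le> t'" using assms by (cases t) auto
    have "w \<in> words m (Suc t')" using that t by (simp add: single_def)
    then show ?thesis using \<open>m \<le> t'\<close>
      by (rule words_Suc_cases) (use hd_last_append t assms in auto)
  qed
  then have "{w \<in> single m t. hd w = t} \<inter> {w \<in> single m t. last w = t} = {}" by blast
  moreover have "single m t = ({w \<in> single m t. hd w = t} \<union> {w \<in> single m t. last w = t})
    \<union> {w \<in> single m t. hd w \<noteq> t \<and> last w \<noteq> t}" by blast
  moreover have "({w \<in> single m t. hd w = t} \<union> {w \<in> single m t. last w = t})
    \<inter> {w \<in> single m t. hd w \<noteq> t \<and> last w \<noteq> t} = {}" by blast
  ultimately show ?thesis
    by (metis (no_types, lifting) card_Un_disjoint finite_Un finite_single)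
qed

lemma words_two: "words m (Suc (Suc m)) = {[Suc m, Suc (Suc m)], [Suc (Suc m), Suc m]}"
proof -
  have "w = [Suc m, Suc (Suc m)] \<or> w = [Suc (Suc m), Suc m]" if "w \<in> words m (Suc (Suc m))" for w
    using that
  proof (rule words_Suc_cases)
    fix u v y
    assume "m \<le> u" "u \<le> Suc m" "v \<in> words u (Suc m)" "y \<in> words m u" "w = v @ Suc (Suc m) # y"
    moreover have "u = m \<or> u = Suc m" using calculation by auto
    ultimately show ?thesis by auto
  qed simp
  moreover have "[Suc m, Suc (Suc m)] \<in> words m (Suc (Suc m))"
    using words_Suc_intro[of m m "Suc m" "[Suc m]" "[]"] by simp
  moreover have "[Suc (Suc m), Suc m] \<in> words m (Suc (Suc m))"
    using words_Suc_intro[of m "Suc m" "Suc m" "[]" "[Suc m]"] by simp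
  ultimately show ?thesis by blast
qed

lemma single_two: "single m (Suc (Suc m)) = {[Suc m, Suc (Suc m)], [Suc (Suc m), Suc m]}"
  by (auto simp: single_def words_two near_def)

text \<open>Length three is exceptional: the left block is a single letter, and the one adjacency is
  between it and the maximum. The resulting count 1 agrees with \<open>F 0\<close>.\<close>

lemma single_three_interior:
  "{w \<in> single m (m + 3). hd w \<noteq> m + 3 \<and> last w \<noteq> m + 3} = {[m + 2, m + 3, m + 1]}"
proof -
  have eq: "m + 3 = Suc (Suc (Suc m))" by simp
  have only: "w = [m + 2, m + 3, m + 1]"
    if w: "w \<in> words m (Suc (Suc (Suc m)))" and ne: "hd w \<noteq> m + 3" "last w \<noteq> m + 3" for w
    using w
  proof (rule words_Suc_cases)
    fix u v y
    assume d: "m \<le> u" "u \<le> Suc (Suc m)" "v \<in> words u (Suc (Suc m))" "y \<in> words m u"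
      "w = v @ Suc (Suc (Suc m)) # y"
    have "u = Suc m" using hd_last_append[OF d(1-4)] ne d(1,2,5) by auto
    then show ?thesis using d by auto
  qed simp
  have mem: "[m + 2, m + 3, m + 1] \<in> words m (m + 3)"
    using words_Suc_intro[of m "Suc m" "Suc (Suc m)" "[Suc (Suc m)]" "[Suc m]"] by (simp add: eq)
  have adj: "adjs [m + 2, m + 3, m + 1] = 1" by (simp add: near_def)
  show ?thesis
  proof (intro equalityI subsetI)
    fix w assume "w \<in> {w \<in> single m (m + 3). hd w \<noteq> m + 3 \<and> last w \<noteq> m + 3}"
    then show "w \<in> {[m + 2, m + 3, m + 1]}" using only[of w] unfolding single_def eq by blast
  next
    fix w assume "w \<in> {[m + 2, m + 3, m + 1]}"
    then show "w \<in> {w \<in> single m (m + 3). hd w \<noteq> m + 3 \<and> last w \<noteq> m + 3}"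
      using mem adj unfolding single_def by simp
  qed
qed

lemma card_filter_not:
  assumes "finite S"
  shows "card {x \<in> S. \<not> P x} = card S - card {x \<in> S. P x}"
proof -
  have "{x \<in> S. \<not> P x} = S - {x \<in> S. P x}" by blast
  then show ?thesis using assms by (simp add: card_Diff_subset)
qed

text \<open>The three counts feed each other's recurrences and are therefore proved together. The
  lower end \<open>m\<close> stays arbitrary because an interior maximum leads to words that start
  above \<open>Suc m\<close>.\<close>

lemma card_single:
  assumes "n \<ge> 2"
  shows "card (single m (m + n)) = F n \<and>
    card {w \<in> single m (m + n). hd w = m + n} = F (n - 2) \<and>
    card {w \<in> single m (m + n). last w = m + n} = F (n - 2)"
  using assms
proof (induction n arbitrary: m rule: less_induct)
  case (less n)
  consider "n = 2" | "n \<ge> 3" using less.prems by linarith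
  then show ?case
  proof cases
    case 1
    have "{w \<in> single m (m + n). hd w = m + n} = {[Suc (Suc m), Suc m]}"
      "{w \<in> single m (m + n). last w = m + n} = {[Suc m, Suc (Suc m)]}"
      "card (single m (m + n)) = 2"
      using 1 by (auto simp: single_two)
    then show ?thesis using 1 by (simp add: numeral_2_eq_2)
  next
    case 2
    define t where "t = m + n - 1"
    have t: "m + n = Suc t" "t = m + (n - 1)" "m + 2 \<le> t" using 2 by (auto simp: t_def)
    obtain k where k: "n = Suc (Suc (Suc k))" using that[of "n - 3"] 2 by simp
    have IH: "card (single m t) = F (n - 1)" "card {w \<in> single m t. hd w = t} = F (n - 3)"
      "card {w \<in> single m t. last w = t} = F (n - 3)"
      using less.IH[of "n - 1" m] 2 unfolding t(2) by (auto simp: numeral_eq_Suc)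
    \<comment> \<open>The Fibonacci recurrence as a subtraction, matching the removal of words whose
      maximum would touch the new one.\<close>
    have diff: "F (n - 1) - F (n - 3) = F (n - 2)" using k by (simp add: numeral_eq_Suc)
    have "card {w \<in> single m (Suc t). hd w = Suc t} = F (n - 2)"
      unfolding single_hd_max[OF t(3)] using IH diff
      by (simp add: card_image card_filter_not[OF finite_single])
    moreover have "card {w \<in> single m (Suc t). last w = Suc t} = F (n - 2)"
      unfolding single_last_max[OF t(3)] using IH diff
      by (simp add: card_image inj_on_def card_filter_not[OF finite_single])
    moreover have "card {w \<in> single m (Suc t). hd w \<noteq> Suc t \<and> last w \<noteq> Suc t} = F (n - 3)"
    proof (cases "n = 3")
      case True
      then have "Suc t = m + 3" using t by simp
      show ?thesis unfolding \<open>Suc t = m + 3\<close> single_three_interior using True by simp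
    next
      case False
      then obtain j where j: "k = Suc j" using k by (cases k) auto
      \<comment> \<open>The left block has \<open>n - 2\<close> letters, at least two here, so the
        induction hypothesis applies to it.\<close>
      have t': "t = Suc m + (n - 2)" "m + 3 \<le> t" using False 2 by (auto simp: t_def)
      have "card (single (Suc m) t) = F (n - 2)"
        "card {w \<in> single (Suc m) t. last w = t} = F (n - 4)"
        using less.IH[of "n - 2" "Suc m"] 2 False unfolding t'(1) by (auto simp: numeral_eq_Suc)
      moreover have "F (n - 2) - F (n - 4) = F (n - 3)" using k j by (simp add: numeral_eq_Suc)
      ultimately show ?thesis unfolding single_max_interior[OF t'(2)]
        by (simp add: card_image inj_on_def card_filter_not[OF finite_single])
    qed
    moreover have "F n = F (n - 2) + F (n - 2) + F (n - 3)" using k by (simp add: numeral_eq_Suc)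
    ultimately show ?thesis unfolding t(1) using card_single_split[of m "Suc t"] t(3) by simp
  qed
qed

section \<open>From permutations in one-line notation to words\<close>

lemma sorted_filter_map_upt:
  "sorted (filter P (map s [a..<b])) \<longleftrightarrow>
    (\<forall>j k. a \<le> j \<and> j < k \<and> k < b \<and> P (s j) \<and> P (s k) \<longrightarrow> s j \<le> (s k :: nat))"
proof (induction "b - a" arbitrary: a)
  case 0
  then show ?case by auto
next
  case (Suc d)
  then have "a < b" by simp
  then have upt: "[a..<b] = a # [Suc a..<b]" by (rule upt_conv_Cons)
  have "sorted (filter P (map s [a..<b])) \<longleftrightarrow>
      (P (s a) \<longrightarrow> (\<forall>k. a < k \<and> k < b \<and> P (s k) \<longrightarrow> s a \<le> s k)) \<and>
      sorted (filter P (map s [Suc a..<b]))"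
    unfolding upt by (auto simp: Suc_le_eq)
  also have "sorted (filter P (map s [Suc a..<b])) \<longleftrightarrow>
    (\<forall>j k. Suc a \<le> j \<and> j < k \<and> k < b \<and> P (s j) \<and> P (s k) \<longrightarrow> s j \<le> s k)"
    using Suc by auto
  finally show ?case using \<open>a < b\<close> by (metis Suc_le_eq le_eq_less_or_eq)
qed

text \<open>Induction on the front index: a pattern either has its smallest entry at position
  \<open>a\<close> or lies entirely behind it.\<close>

lemma avoiding_map_upt:
  "avoiding (map s [a..<b]) \<longleftrightarrow>
    \<not> (\<exists>i j k. a \<le> i \<and> i < j \<and> j < k \<and> k < b \<and> s i < s k \<and> s k < s j)"
proof (induction "b - a" arbitrary: a)
  case 0
  then show ?case by auto
next
  case (Suc d)
  then have "a < b" by simp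
  then have upt: "[a..<b] = a # [Suc a..<b]" by (rule upt_conv_Cons)
  have "avoiding (map s [a..<b]) \<longleftrightarrow>
      \<not> (\<exists>j k. a < j \<and> j < k \<and> k < b \<and> s a < s k \<and> s k < s j) \<and> avoiding (map s [Suc a..<b])"
    unfolding upt by (simp add: sorted_filter_map_upt Suc_le_eq not_less)
       (meson less_le_trans leI less_trans not_le)
  also have "avoiding (map s [Suc a..<b]) \<longleftrightarrow>
    \<not> (\<exists>i j k. Suc a \<le> i \<and> i < j \<and> j < k \<and> k < b \<and> s i < s k \<and> s k < s j)"
    using Suc by auto
  finally show ?case by (metis Suc_le_eq le_eq_less_or_eq)
qed

lemma avoids_132_iff: "avoids_132 n s \<longleftrightarrow> avoiding (map s [1..<Suc n])"
  unfolding avoids_132_def avoiding_map_upt by (simp add: less_Suc_eq_le)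

lemma adjs_map_upt:
  "adjs (map s [1..<Suc n]) = card {i. 1 \<le> i \<and> i < n \<and> near (s i) (s (Suc i))}"
proof -
  let ?w = "map s [1..<Suc n]"
  have "adjs ?w = card {i. i < length (zip ?w (tl ?w)) \<and> (\<lambda>(x, y). near x y) (zip ?w (tl ?w) ! i)}"
    unfolding adjs_def by (rule length_filter_conv_card)
  also have "{i. i < length (zip ?w (tl ?w)) \<and> (\<lambda>(x, y). near x y) (zip ?w (tl ?w) ! i)} =
      {i. i < n - 1 \<and> near (s (Suc i)) (s (Suc (Suc i)))}"
    by (auto simp: nth_tl simp del: upt_Suc)
  \<comment> \<open>List positions start at 0 and entries of the permutation at 1, hence the shift
    by \<open>Suc\<close>.\<close>
  also have "card \<dots> = card (Suc ` \<dots>)" by (simp add: card_image)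
  also have "Suc ` {i. i < n - 1 \<and> near (s (Suc i)) (s (Suc (Suc i)))} =
      {i. 1 \<le> i \<and> i < n \<and> near (s i) (s (Suc i))}"
  proof (intro equalityI subsetI)
    fix i assume "i \<in> {i. 1 \<le> i \<and> i < n \<and> near (s i) (s (Suc i))}"
    then show "i \<in> Suc ` {i. i < n - 1 \<and> near (s (Suc i)) (s (Suc (Suc i)))}"
      by (cases i) auto
  qed auto
  finally show ?thesis .
qed

text \<open>With \<open>D\<close> the left positions of adjacent pairs, the union is the set of
  positions that \<open>box\<close> counts. The minimum of a nonempty \<open>D\<close> is not in the
  shifted copy, so the union has more elements than \<open>D\<close>.\<close>

lemma card_Un_Suc_image_eq_2:
  fixes D :: "nat set"
  assumes "finite D"
  shows "card (D \<union> Suc ` D) = 2 \<longleftrightarrow> card D = 1"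
proof
  assume "card D = 1"
  then obtain i where "D = {i}" by (auto simp: card_1_singleton_iff)
  then show "card (D \<union> Suc ` D) = 2" by simp
next
  assume c: "card (D \<union> Suc ` D) = 2"
  then have ne: "D \<noteq> {}" by auto
  have "Min D \<notin> Suc ` D" using assms by (auto dest: Min_le)
  then have "Suc (card D) = card (insert (Min D) (Suc ` D))"
    using assms by (simp add: card_image)
  also have "\<dots> \<le> card (D \<union> Suc ` D)"
    using assms ne by (intro card_mono) auto
  finally have "card D \<le> 1" using c by simp
  then show "card D = 1" using assms ne by (simp add: card_gt_0_iff le_Suc_eq)
qed

text \<open>\<open>box\<close> counts entries and \<open>adjs\<close> counts pairs. An entry is
  counted exactly when it is the left or the right member of a pair.\<close>

lemma box_eq_2_iff: "box n s = 2 \<longleftrightarrow> adjs (map s [1..<Suc n]) = 1"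
proof -
  let ?D = "{i. 1 \<le> i \<and> i < n \<and> near (s i) (s (Suc i))}"
  have near: "\<bar>int x - int y\<bar> = 1 \<longleftrightarrow> near x y" for x y by (auto simp: near_def)
  have "{i \<in> {1..n}. (i < n \<and> \<bar>int (s i) - int (s (i + 1))\<bar> = 1) \<or>
     (1 < i \<and> \<bar>int (s (i - 1)) - int (s i)\<bar> = 1)} = ?D \<union> Suc ` ?D"
  proof (intro equalityI subsetI)
    fix i assume "i \<in> {i \<in> {1..n}. (i < n \<and> \<bar>int (s i) - int (s (i + 1))\<bar> = 1) \<or>
     (1 < i \<and> \<bar>int (s (i - 1)) - int (s i)\<bar> = 1)}"
    then show "i \<in> ?D \<union> Suc ` ?D" unfolding near by (cases i) auto
  qed (auto simp: near)
  then have "box n s = card (?D \<union> Suc ` ?D)" by (simp add: box_def)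
  moreover have "finite ?D" by simp
  ultimately show ?thesis
    unfolding adjs_map_upt using card_Un_Suc_image_eq_2[of ?D] by simp
qed

lemma one_line_bij:
  "bij_betw (\<lambda>s. map s [1..<Suc n]) {s \<in> S132 n. box n s = 2} (single 0 n)"
proof (rule bij_betw_imageI)
  show "inj_on (\<lambda>s. map s [1..<Suc n]) {s \<in> S132 n. box n s = 2}"
  proof (rule inj_onI)
    fix s r assume s: "s \<in> {s \<in> S132 n. box n s = 2}" and r: "r \<in> {s \<in> S132 n. box n s = 2}"
      and eq: "map s [1..<Suc n] = map r [1..<Suc n]"
    show "s = r"
    proof
      fix i
      show "s i = r i"
      proof (cases "i \<in> {1..n}")
        case True
        then show ?thesis using eq by (auto simp del: upt_Suc)
      next
        case False
        then show ?thesis using s r by (auto simp: S132_def permutes_def)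
      qed
    qed
  qed
  show "(\<lambda>s. map s [1..<Suc n]) ` {s \<in> S132 n. box n s = 2} = single 0 n"
  proof (intro equalityI subsetI)
    fix w assume "w \<in> (\<lambda>s. map s [1..<Suc n]) ` {s \<in> S132 n. box n s = 2}"
    then obtain s where w: "w = map s [1..<Suc n]" and s: "s permutes {1..n}" "avoids_132 n s"
      "box n s = 2" by (auto simp: S132_def)
    have "set [1..<Suc n] = {1..n}" by auto
    then have "set w = {1..n}" "distinct w"
      using permutes_image[OF s(1)] permutes_inj_on[OF s(1)] unfolding w
      by (simp_all add: distinct_map del: upt_Suc)
    moreover have "{1..n} = {0<..n}" by auto
    ultimately show "w \<in> single 0 n"
      using s by (simp add: single_def words_def avoids_132_iff box_eq_2_iff w del: upt_Suc)
  next
    fix w assume "w \<in> single 0 n"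
    then have w: "distinct w" "avoiding w" "set w = {0<..n}" "adjs w = 1" "length w = n"
      by (auto simp: single_def words_def length_words dest: distinct_card)
    \<comment> \<open>The inverse of the one-line map: positions are shifted by one, and the
      identity outside \<open>{1..n}\<close> is what \<open>permutes\<close> demands.\<close>
    define s where "s i = (if i \<in> {1..n} then w ! (i - 1) else i)" for i
    have ws: "map s [1..<Suc n] = w"
      by (rule nth_equalityI) (auto simp: s_def w(5) simp del: upt_Suc)
    have "bij_betw s {1..n} {1..n}"
    proof (rule bij_betw_imageI)
      have "distinct (map s [1..<Suc n])" unfolding ws by (rule w(1))
      then show "inj_on s {1..n}"
        by (simp add: distinct_map atLeastLessThanSuc_atLeastAtMost del: upt_Suc)
      have "s ` set [1..<Suc n] = {0<..n}" unfolding set_map[symmetric] ws by (rule w(3))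
      then show "s ` {1..n} = {1..n}"
        by (simp add: atLeastLessThanSuc_atLeastAtMost atLeastSucAtMost_greaterThanAtMost del: upt_Suc)
    qed
    then have "s permutes {1..n}" by (rule bij_imp_permutes) (auto simp: s_def)
    then have "s \<in> {s \<in> S132 n. box n s = 2}"
      using w ws by (simp add: S132_def avoids_132_iff box_eq_2_iff del: upt_Suc)
    then show "w \<in> (\<lambda>s. map s [1..<Suc n]) ` {s \<in> S132 n. box n s = 2}" using ws by force
  qed
qed

text \<open>Restricts the bijection by a side condition that can be read off the word: none, one on
  the first entry, or one on the last entry.\<close>

lemma card_one_line:
  assumes "\<And>s. P s \<longleftrightarrow> Q (map s [1..<Suc n])"
  shows "card {s \<in> S132 n. P s \<and> box n s = 2} = card {w \<in> single 0 n. Q w}"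
proof -
  let ?f = "\<lambda>s. map s [1..<Suc n]"
  have img: "?f ` {s \<in> S132 n. box n s = 2} = single 0 n"
    using one_line_bij by (rule bij_betw_imp_surj_on)
  have "inj_on ?f {s \<in> S132 n. P s \<and> box n s = 2}"
    using one_line_bij by (rule inj_on_subset[OF bij_betw_imp_inj_on]) auto
  then have "card {s \<in> S132 n. P s \<and> box n s = 2} = card (?f ` {s \<in> S132 n. P s \<and> box n s = 2})"
    by (rule card_image[symmetric])
  also have "?f ` {s \<in> S132 n. P s \<and> box n s = 2} = {w \<in> single 0 n. Q w}"
    unfolding img[symmetric] using assms by blast
  finally show ?thesis .
qed

section \<open>Coefficients of the generating polynomials\<close>

lemma coeff_sum_monom_box:
  assumes "finite S"
  shows "coeff (\<Sum>s\<in>S. monom (1 :: int) (f s)) k = int (card {s \<in> S. f s = k})"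
  using assms by (simp add: coeff_sum sum.If_cases Collect_conj_eq)

lemma finite_S132: "finite (S132 n)"
  by (rule finite_subset[OF _ finite_permutations[of "{1..n}"]]) (auto simp: S132_def)

theorem theorem3:
  fixes n :: nat
  assumes "n \<ge> 2"
  shows "coeff (A n) 2 = int (F n) \<and>
         coeff (B n) 2 = int (F (n - 2)) \<and>
         coeff (E n) 2 = int (F (n - 2))"
proof -
  \<comment> \<open>The condition \<open>True\<close> makes the unrestricted count an instance of
    \<open>card_one_line\<close>.\<close>
  have "card {s \<in> S132 n. True \<and> box n s = 2} = card {w \<in> single 0 n. True}"
    by (rule card_one_line) simp
  then have "coeff (A n) 2 = int (card (single 0 n))"
    by (simp add: A_def coeff_sum_monom_box finite_S132)
  moreover have "card {s \<in> S132 n. s 1 = n \<and> box n s = 2} = card {w \<in> single 0 n. hd w = n}"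
    by (rule card_one_line) (use assms in \<open>simp add: hd_map del: upt_Suc\<close>)
  then have "coeff (B n) 2 = int (card {w \<in> single 0 n. hd w = n})"
    by (simp add: B_def coeff_sum_monom_box finite_S132)
  moreover have "card {s \<in> S132 n. s n = n \<and> box n s = 2} = card {w \<in> single 0 n. last w = n}"
    by (rule card_one_line) (use assms in \<open>simp add: last_map\<close>)
  then have "coeff (E n) 2 = int (card {w \<in> single 0 n. last w = n})"
    by (simp add: E_def coeff_sum_monom_box finite_S132)
  ultimately show ?thesis using card_single[OF assms, of 0] by simp
qed

end
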